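(* Let $k$ and $i$ be integers with $2 \le i \le k-1$. The payoff query complexity of finding a $\left(1-\frac1i\right)$-approximate Nash equilibrium of a $k\times k$ bimatrix game (with payoffs in $[0,1]$) is at least $k-i+1$.
   Context: A $k\times k$ bimatrix game is a pair $(R,C)$ of $k\times k$ matrices: $R$ gives the payoffs of the row player and $C$ those of the column player; all payoffs are assumed to lie in $[0,1]$. A mixed strategy is a probability distribution over $[k]=\{1,\dots,k\}$. Under a mixed strategy profile $(\mathbf x,\mathbf y)$ the row player's regret is $\max_{j\in[k]}(R_j\cdot\mathbf y)-\mathbf x\cdot R\cdot\mathbf y$ and the column player's regret is $\max_{j\in[k]}(\mathbf x\cdot C)_j-\mathbf x\cdot C\cdot\mathbf y$. The profile is an $\epsilon$-Nash equilibrium ($\epsilon$-approximate Nash equilibrium) if both regrets are at most $\epsilon$. A payoff query selects a pure-strategy profile (row $r$, column $c$) and receives as response the payoffs $R_{r,c}$ and $C_{r,c}$. The payoff query complexity of a class of games with respect to a solution concept is the smallest $N$ such that some (deterministic) algorithm, initially knowing none of the payoffs, finds a solution of every game in the class using at most $N$ payoff queries. Queries may be chosen adaptively, and no computational bound is imposed on the algorithm. *)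

theory Defs
  imports "HOL-Analysis.Analysis" "HOL-Library.Extended_Nat"
begin

text \<open>
  The pure strategies of either player are the elements of a finite type \<open>'k\<close>, so a
  \<open>k \<times> k\<close> game is one with \<open>CARD('k) = k\<close>. The entry \<open>R $ r $ c\<close> lies in row \<open>r\<close> and
  column \<open>c\<close>.
\<close>

type_synonym 'k bimatrix = "(real ^ 'k ^ 'k) \<times> (real ^ 'k ^ 'k)"

type_synonym 'k profile = "(real ^ 'k) \<times> (real ^ 'k)"

definition bimatrix_games :: "('k::finite) bimatrix set" where
  "bimatrix_games = {(R, C). \<forall>r c. R $ r $ c \<in> {0..1} \<and> C $ r $ c \<in> {0..1}}"

definition mixed_strategy :: "real ^ ('k::finite) \<Rightarrow> bool" where
  "mixed_strategy x \<longleftrightarrow> (\<forall>j. 0 \<le> x $ j) \<and> (\<Sum>j\<in>UNIV. x $ j) = 1"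

fun row_regret :: "('k::finite) bimatrix \<Rightarrow> 'k profile \<Rightarrow> real" where
  "row_regret (R, C) (x, y) = (MAX j. (R $ j) \<bullet> y) - x \<bullet> (R *v y)"

fun col_regret :: "('k::finite) bimatrix \<Rightarrow> 'k profile \<Rightarrow> real" where
  "col_regret (R, C) (x, y) = (MAX j. (x v* C) $ j) - x \<bullet> (C *v y)"

definition approx_nash :: "real \<Rightarrow> ('k::finite) bimatrix \<Rightarrow> 'k profile \<Rightarrow> bool" where
  "approx_nash \<epsilon> G s \<longleftrightarrow>
     mixed_strategy (fst s) \<and> mixed_strategy (snd s) \<and> row_regret G s \<le> \<epsilon> \<and> col_regret G s \<le> \<epsilon>"

text \<open>
  A deterministic adaptive algorithm is a decision tree: it either stops with an output, or
  queries row \<open>r\<close> and column \<open>c\<close> and continues with a subtree depending on the pair of payoffs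
  received. The branching is over all pairs of reals and arbitrary, so there is no computational
  restriction. Every branch is finite, but there need not be a uniform bound on the depth.
\<close>

datatype ('k, 's) query_alg = Output 's | Query 'k 'k "real \<times> real \<Rightarrow> ('k, 's) query_alg"

primrec alg_output :: "('k::finite, 's) query_alg \<Rightarrow> 'k bimatrix \<Rightarrow> 's" where
  "alg_output (Output s) G = s"
| "alg_output (Query r c next) G = alg_output (next (fst G $ r $ c, snd G $ r $ c)) G"

primrec num_queries :: "('k::finite, 's) query_alg \<Rightarrow> 'k bimatrix \<Rightarrow> nat" where
  "num_queries (Output s) G = 0"
| "num_queries (Query r c next) G = Suc (num_queries (next (fst G $ r $ c, snd G $ r $ c)) G)"

text \<open>The value is \<open>\<infinity>\<close> if no algorithm solves the whole class with a bounded number of queries.\<close>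

definition payoff_query_complexity ::
    "('k::finite) bimatrix set \<Rightarrow> ('k bimatrix \<Rightarrow> 's \<Rightarrow> bool) \<Rightarrow> enat" where
  "payoff_query_complexity \<G> sol =
     Inf {enat N | N. \<exists>A. \<forall>G\<in>\<G>. sol G (alg_output A G) \<and> num_queries A G \<le> N}"

end

theory Submission imports Defs
begin

text \<open>
  The adversary answers every query with zero payoffs. If at most \<open>k - i\<close> queries \<open>Q\<close> are made, at
  least \<open>i\<close> columns are never queried. Should the output \<open>(x, y)\<close> give one of them, \<open>c\<close>, probability
  less than \<open>1 / i\<close>, then the column player regrets not playing \<open>c\<close> in the consistent game in which
  \<open>c\<close> always pays \<open>1\<close> and everything else pays \<open>0\<close>. Otherwise \<open>y\<close> is supported on the unqueried
  columns. Some row \<open>r\<close> has \<open>x r \<le> 1 / k < 1 / i\<close>, and the row player regrets not playing \<open>r\<close> in the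
  consistent game in which the cells of row \<open>r\<close> outside \<open>Q\<close> pay \<open>1\<close>.
\<close>

primrec queried :: "('k::finite, 's) query_alg \<Rightarrow> 'k bimatrix \<Rightarrow> ('k \<times> 'k) set" where
  "queried (Output s) G = {}"
| "queried (Query r c next) G =
     insert (r, c) (queried (next (fst G $ r $ c, snd G $ r $ c)) G)"

lemma finite_queried: "finite (queried A G)"
  by (induction A) auto

lemma card_queried_le: "card (queried A G) \<le> num_queries A G"
proof (induction A)
  case (Query r c f)
  then show ?case
    by (auto simp: card_insert_if finite_queried intro: le_SucI)
qed simp

text \<open>A run depends on the game only through the replies, so equal replies lead to the same
  leaf. Only cells on the path taken for \<open>G\<close> are constrained, which lets an adversary
  fix the others afterwards.\<close>

lemma alg_output_cong:
  assumes "\<And>r c. (r, c) \<in> queried A G \<Longrightarrow>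
    fst H $ r $ c = fst G $ r $ c \<and> snd H $ r $ c = snd G $ r $ c"
  shows "alg_output A H = alg_output A G"
  using assms by (induction A) auto

text \<open>Against any \<open>x\<close> the pure column \<open>c\<close> earns 1, whereas the
  profile earns only the weight that \<open>y\<close> puts on \<open>c\<close>.\<close>

lemma col_regret_single_column:
  fixes x y :: "real ^ 'k::finite"
  assumes "mixed_strategy x"
  shows "col_regret (R, \<chi> r c'. of_bool (c' = c)) (x, y) \<ge> 1 - y $ c"
proof -
  let ?C = "\<chi> r c'. of_bool (c' = c) :: real ^ 'k ^ 'k"
  have sum_x: "(\<Sum>j\<in>UNIV. x $ j) = 1"
    using assms by (simp add: mixed_strategy_def)
  have "?C *v y = (\<chi> r. y $ c)"
    by (simp add: vec_eq_iff matrix_vector_mult_def of_bool_def if_distrib[of "\<lambda>u. u * _"] cong: if_cong)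
  then have payoff: "x \<bullet> (?C *v y) = y $ c"
    by (simp add: inner_vec_def sum_x flip: sum_distrib_right)
  have "(x v* ?C) $ c = 1"
    by (simp add: vector_matrix_mult_def sum_x)
  then have "(MAX j. (x v* ?C) $ j) \<ge> 1"
    by (metis Max_ge finite_imageI finite rangeI)
  with payoff show ?thesis
    by simp
qed

text \<open>All of the mass of \<open>y\<close> lies in \<open>S\<close>, so row \<open>r\<close>
  earns 1 and every other row earns 0; the profile earns just \<open>x $ r\<close>.\<close>

lemma row_regret_single_row:
  fixes x y :: "real ^ 'k::finite"
  assumes "mixed_strategy y" and "\<And>c. c \<notin> S \<Longrightarrow> y $ c = 0"
  shows "row_regret (\<chi> r' c. of_bool (r' = r \<and> c \<in> S), C) (x, y) \<ge> 1 - x $ r"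
proof -
  let ?R = "\<chi> r' c. of_bool (r' = r \<and> c \<in> S) :: real ^ 'k ^ 'k"
  have "(\<Sum>c\<in>UNIV. of_bool (c \<in> S) * y $ c) = (\<Sum>c\<in>UNIV. y $ c)"
    using assms(2) by (intro sum.cong) auto
  then have sum_S: "(\<Sum>c\<in>UNIV. of_bool (c \<in> S) * y $ c) = 1"
    using assms(1) by (simp add: mixed_strategy_def)
  have "?R *v y = (\<chi> r'. of_bool (r' = r))"
    by (auto simp: vec_eq_iff matrix_vector_mult_def sum_S of_bool_conj)
  then have payoff: "x \<bullet> (?R *v y) = x $ r"
    by (simp add: inner_vec_def of_bool_def if_distrib[of "\<lambda>u. _ * u"] cong: if_cong)
  have "(?R $ r) \<bullet> y = 1"
    by (simp add: inner_vec_def sum_S)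
  then have "(MAX j. (?R $ j) \<bullet> y) \<ge> 1"
    by (intro Max_ge_iff[THEN iffD2]) (auto intro!: exI[of _ r])
  with payoff show ?thesis
    by simp
qed

lemma mixed_strategy_le_inverse_card:
  fixes x :: "real ^ 'k::finite"
  assumes "mixed_strategy x"
  obtains r where "x $ r \<le> 1 / CARD('k)"
proof (rule ccontr)
  assume "\<not> thesis"
  with that have "1 / CARD('k) < x $ r" for r
    by (meson not_le)
  then have "(\<Sum>r\<in>(UNIV :: 'k set). 1 / CARD('k)) < (\<Sum>r\<in>UNIV. x $ r)"
    by (intro sum_strict_mono) auto
  with assms show False
    by (simp add: mixed_strategy_def)
qed

text \<open>At least \<open>i\<close> entries of size at least \<open>1 / i\<close> already exhaust
  the total mass 1.\<close>

lemma mixed_strategy_vanishes_outside: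
  fixes y :: "real ^ 'k::finite"
  assumes "mixed_strategy y" and "i > 0" and "i \<le> card U"
    and "\<And>c. c \<in> U \<Longrightarrow> 1 / real i \<le> y $ c" and "d \<notin> U"
  shows "y $ d = 0"
proof -
  have "1 \<le> card U * (1 / real i)"
    using assms(2,3) by (simp add: field_simps)
  also have "\<dots> \<le> (\<Sum>c\<in>U. y $ c)"
    using assms(4) by (intro sum_bounded_below) auto
  finally have "1 + y $ d \<le> (\<Sum>c\<in>insert d U. y $ c)"
    using \<open>d \<notin> U\<close> by simp
  also have "\<dots> \<le> (\<Sum>c\<in>UNIV. y $ c)"
    using assms(1) by (intro sum_mono2) (auto simp: mixed_strategy_def)
  finally show ?thesis
    using assms(1) by (auto simp: mixed_strategy_def intro: antisym)
qed

text \<open>The game may depend on \<open>(x, y)\<close>: after seeing only zeros an algorithm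
  commits to one output, so defeating that single profile suffices.\<close>

lemma no_uniform_approx_nash:
  fixes Q :: "('k::finite \<times> 'k) set"
  assumes "0 < i" and "i < CARD('k)" and "card Q \<le> CARD('k) - i"
  obtains R C where "(R, C) \<in> bimatrix_games"
    and "\<And>r c. (r, c) \<in> Q \<Longrightarrow> R $ r $ c = 0 \<and> C $ r $ c = 0"
    and "\<not> approx_nash (1 - 1 / real i) (R, C) (x, y)"
proof (cases "mixed_strategy x \<and> mixed_strategy y")
  case False
  \<comment> \<open>A profile that is not a pair of mixed strategies fails in every game, so the
    zero game serves.\<close>
  show thesis
    by (rule that[of 0 0]) (use False in \<open>auto simp: bimatrix_games_def approx_nash_def\<close>)
next
  case True
  define U where "U = - snd ` Q"
  have "card (snd ` Q) \<le> card Q"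
    by (simp add: card_image_le)
  then have card_U: "i \<le> card U"
    using assms by (simp add: U_def Compl_eq_Diff_UNIV card_Diff_subset)
  show thesis
  proof (cases "\<exists>c\<in>U. y $ c < 1 / real i")
    case light: True
    then obtain c where c: "c \<in> U" "y $ c < 1 / real i"
      by blast
    let ?C = "\<chi> r c'. of_bool (c' = c) :: real ^ 'k ^ 'k"
    show thesis
    proof (rule that[of 0 ?C])
      show "\<not> approx_nash (1 - 1 / real i) (0, ?C) (x, y)"
        using c(2) True col_regret_single_column[of x y c 0] by (auto simp: approx_nash_def)
      show "0 $ r $ c' = 0 \<and> ?C $ r $ c' = 0" if "(r, c') \<in> Q" for r c'
        using c(1) that by (force simp: U_def)
    qed (auto simp: bimatrix_games_def)
  next
    case False
    obtain r where r: "x $ r \<le> 1 / CARD('k)"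
      using mixed_strategy_le_inverse_card True by blast
    \<comment> \<open>The strict \<open>i < CARD('k)\<close> enters here: the regret must exceed
      \<open>1 - 1 / real i\<close>, not merely reach it.\<close>
    also have "\<dots> < 1 / real i"
      using assms by (simp add: field_simps)
    finally have r: "x $ r < 1 / real i" .
    have "y $ d = 0" if "d \<notin> U" for d
      using mixed_strategy_vanishes_outside[OF _ assms(1) card_U _ that] True False by force
    \<comment> \<open>A cell of row \<open>r\<close> in \<open>Q\<close> lies in a queried column,
      hence outside \<open>U\<close>.\<close>
    then have supp: "y $ d = 0" if "d \<notin> {d. (r, d) \<notin> Q}" for d
      using that by (force simp: U_def)
    let ?R = "\<chi> r' c. of_bool (r' = r \<and> c \<in> {d. (r, d) \<notin> Q}) :: real ^ 'k ^ 'k"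
    show thesis
    proof (rule that[of ?R 0])
      show "\<not> approx_nash (1 - 1 / real i) (?R, 0) (x, y)"
        using r True row_regret_single_row[of y "{d. (r, d) \<notin> Q}" x r 0] supp
        by (auto simp: approx_nash_def)
    qed (auto simp: bimatrix_games_def)
  qed
qed

theorem theorem7:
  fixes k i :: nat
  assumes "CARD('k::finite) = k" and "2 \<le> i" and "i \<le> k - 1"
  shows "payoff_query_complexity (bimatrix_games :: 'k bimatrix set)
           (approx_nash (1 - 1 / real i)) \<ge> enat (k - i + 1)"
  unfolding payoff_query_complexity_def
proof (rule Inf_greatest, clarify)
  fix N and A :: "('k, 'k profile) query_alg"
  assume A: "\<forall>G\<in>bimatrix_games.
    approx_nash (1 - 1 / real i) G (alg_output A G) \<and> num_queries A G \<le> N"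
  let ?Z = "(0, 0) :: 'k bimatrix"
  obtain x y where out: "alg_output A ?Z = (x, y)"
    by fastforce
  have "?Z \<in> bimatrix_games"
    by (simp add: bimatrix_games_def)
  with A have card_Q: "card (queried A ?Z) \<le> N"
    using card_queried_le order_trans by blast
  have "k - i + 1 \<le> N"
  proof (rule ccontr)
    assume "\<not> k - i + 1 \<le> N"
    \<comment> \<open>Subtraction is truncated: \<open>2 \<le> i\<close> excludes
      \<open>k = 0\<close>, so \<open>i \<le> k - 1\<close> does give \<open>i < k\<close>.\<close>
    with card_Q assms have "card (queried A ?Z) \<le> CARD('k) - i" "0 < i" "i < CARD('k)"
      by auto
    then obtain R C where RC: "(R, C) \<in> bimatrix_games"
      and agree: "\<And>r c. (r, c) \<in> queried A ?Z \<Longrightarrow> R $ r $ c = 0 \<and> C $ r $ c = 0"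
      and bad: "\<not> approx_nash (1 - 1 / real i) (R, C) (x, y)"
      using no_uniform_approx_nash[of i "queried A ?Z" x y] by blast
    have "alg_output A (R, C) = alg_output A ?Z"
      by (rule alg_output_cong) (simp add: agree)
    with A RC bad out show False
      by metis
  qed
  then show "enat (k - i + 1) \<le> enat N"
    by simp
qed

end
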